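(* For every real $\varepsilon>0$ there exists a constant $C=C(\varepsilon)$ such that for every positive integer $t$ whose binary expansion contains at least $C$ blocks of consecutive $\mathtt 1$s, we have \[c_t+c_{t'}>1-\varepsilon,\] where $t'=3\cdot 2^\lambda-t$ and $\lambda\ge 0$ is the integer determined by $2^\lambda\leq t<2^{\lambda+1}$.
   Context: For a nonnegative integer $n$, $s(n)$ denotes the binary sum of digits of $n$, i.e. $s(\varepsilon_\nu 2^\nu+\cdots+\varepsilon_0 2^0)=\varepsilon_\nu+\cdots+\varepsilon_0$ for digits $\varepsilon_i\in\{0,1\}$. For a nonnegative integer $t$, \[c_t=\lim_{N\to\infty}\frac1N\left|\{0\le n<N: s(n+t)\geq s(n)\}\right|,\] that is, $c_t$ is the asymptotic density of the set $\{n\ge 0: s(n+t)\ge s(n)\}$. This limit always exists, since the set is a finite union of arithmetic progressions. A block of consecutive $\mathtt 1$s in the binary expansion of $t$ is a maximal run of consecutive digits equal to $\mathtt 1$ (for example, $t=(1101001)_2$ has three blocks). *)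

theory Defs
  imports Complex_Main
begin

(* All digits of index n or higher vanish, because n < 2 ^ n. *)
definition bin_digit_sum :: "nat \<Rightarrow> nat" where
  "bin_digit_sum n = (\<Sum>i<n. of_bool (bit n i))"

(* The limit exists for every t: a long enough carry makes the digit sum drop, so only finitely
   many low digits of n matter and the set is a finite union of arithmetic progressions. *)
definition cusick_density :: "nat \<Rightarrow> real" where
  "cusick_density t =
     lim (\<lambda>N. real (card {n. n < N \<and> bin_digit_sum (n + t) \<ge> bin_digit_sum n}) / real N)"

(* The digits at the positions a, ..., b form a maximal run of 1s;
   position 0 is the least significant digit. *)
definition is_one_block :: "nat \<Rightarrow> nat \<Rightarrow> nat \<Rightarrow> bool" where
  "is_one_block t a b \<longleftrightarrow>
     a \<le> b \<and> (\<forall>i\<in>{a..b}. bit t i) \<and> \<not> bit t (b + 1) \<and> (a = 0 \<or> \<not> bit t (a - 1))"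

definition num_one_blocks :: "nat \<Rightarrow> nat" where
  "num_one_blocks t = card {(a, b). is_one_block t a b}"

end

theory Submission
  imports Defs
begin

text \<open>
  Write \<open>s\<close> for the binary digit sum, and \<open>t = 2 ^ l + r\<close> with \<open>0 \<le> r < 2 ^ l\<close>, so that
  \<open>t' = 2 ^ l + (2 ^ l - r)\<close>. Split \<open>n = 2 ^ l * m + k\<close> with \<open>k < 2 ^ l\<close>. Then
  \<open>s (n + t) - s n\<close> is \<open>X + D\<close>, where \<open>X = s ((k + r) mod 2 ^ l) - s k\<close> comes from the low
  digits and \<open>D\<close> is \<open>s (m + 1) - s m\<close> or \<open>s (m + 2) - s m\<close>, according to the carry out of the
  low digits. The two possibilities for \<open>D\<close> have the same law, with tail
  \<open>G x = P(D \<ge> x) = 1 - 2 ^ (x - 2)\<close> for \<open>x \<le> 2\<close> and \<open>0\<close> beyond (\<open>carry_tail\<close>). Hence \<open>D\<close> is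
  independent of \<open>X\<close>, and the density of \<open>t\<close> is the mean of \<open>G (- X)\<close>
  (\<open>has_density_increment\<close>). The map \<open>k \<mapsto> (k + r) mod 2 ^ l\<close> turns \<open>X\<close> for \<open>2 ^ l - r\<close> into \<open>- X\<close>
  for \<open>r\<close> (\<open>increment_mean_reflect\<close>), so the density of \<open>t'\<close> is the mean of \<open>G X\<close>.

  Now \<open>G x + G (- x) \<ge> 1 - 2 ^ (- \<bar>x\<bar> - 2)\<close>, and it remains to show that the mean of
  \<open>2 ^ (- \<bar>X\<bar> - 2)\<close> is small, that is, that \<open>X\<close> does not concentrate. At the start of a block of 1s of \<open>r\<close>,
  preceded by a 0, suitable values of the two neighbouring digits of \<open>k\<close> confine the effect of the
  digit of \<open>k\<close> between them: it creates or avoids one carry, changes \<open>X\<close> by exactly 1, and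
  influences no other place. Thus, with a fixed positive probability, each such place
  contributes an independent fair coin to \<open>X\<close>, and the sum of many coins spreads out.

  The quantitative form is an induction over the digits (\<open>smooth_mean_bound_blocks\<close>). Averaging over
  \<open>n\<close> coins replaces the test function \<open>geom\<close>, \<open>2 ^ (- \<bar>x\<bar> - 2)\<close>, by its binomial smoothing
  \<open>smooth_geom n\<close>. If \<open>w\<close> bounds \<open>smooth_geom m\<close>, then \<open>w + 2 ^ m / 2 ^ n\<close> bounds \<open>smooth_geom n\<close> for every
  \<open>n\<close>, and every group of three digits with a block start in its middle trades part of the mean
  at \<open>n\<close> for the mean at \<open>n + 1\<close>, where the second term is half as large. After \<open>M\<close> such groups
  the mean of \<open>geom\<close> is at most \<open>w + 2 ^ m * (7 / 8) ^ M\<close>. Here \<open>w\<close> can be chosen arbitrarily small because the central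
  binomial coefficients are \<open>o(4 ^ p)\<close>, and then \<open>M\<close> makes the second term small.
\<close>

section \<open>The digit sum and natural density\<close>

lemma not_bit_of_less_power:
  fixes n :: nat
  assumes "n < 2 ^ k" "k \<le> i"
  shows "\<not> bit n i"
proof -
  have "n < 2 ^ i"
    using assms(1) power_increasing[OF assms(2), of "2 :: nat"] by linarith
  then show ?thesis by (simp add: bit_iff_odd)
qed

lemma bin_digit_sum_eq_sum:
  assumes "n \<le> N"
  shows "bin_digit_sum n = (\<Sum>i<N. of_bool (bit n i))"
proof -
  have "\<not> bit n i" if "n \<le> i" for i
    using not_bit_of_less_power[of n n i] that less_exp[of n] by simp
  then show ?thesis
    unfolding bin_digit_sum_def using assms
    by (intro sum.mono_neutral_left) auto
qed

lemma bin_digit_sum_double: "bin_digit_sum (2 * n) = bin_digit_sum n"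
proof -
  have "bin_digit_sum (2 * n) = (\<Sum>i<Suc (2 * n). of_bool (bit (2 * n) i))"
    by (rule bin_digit_sum_eq_sum) simp
  also have "\<dots> = (\<Sum>i<2 * n. of_bool (bit n i))"
    by (subst sum.lessThan_Suc_shift) (simp add: bit_Suc bit_0)
  also have "\<dots> = bin_digit_sum n"
    by (rule bin_digit_sum_eq_sum[symmetric]) simp
  finally show ?thesis .
qed

lemma bin_digit_sum_Suc_double: "bin_digit_sum (Suc (2 * n)) = Suc (bin_digit_sum n)"
proof -
  have "bin_digit_sum (Suc (2 * n)) = (\<Sum>i<Suc (2 * n). of_bool (bit (Suc (2 * n)) i))"
    by (rule bin_digit_sum_eq_sum) simp
  also have "\<dots> = Suc (\<Sum>i<2 * n. of_bool (bit n i))"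
    by (subst sum.lessThan_Suc_shift) (simp add: bit_Suc bit_0)
  also have "(\<Sum>i<2 * n. of_bool (bit n i)) = bin_digit_sum n"
    by (rule bin_digit_sum_eq_sum[symmetric]) simp
  finally show ?thesis .
qed

definition has_density :: "(nat \<Rightarrow> bool) \<Rightarrow> real \<Rightarrow> bool" where
  "has_density P d \<longleftrightarrow> (\<lambda>N. real (card {n. n < N \<and> P n}) / real N) \<longlonglongrightarrow> d"

text \<open>
  Splitting \<open>n\<close> by its last binary digit lets densities follow the recursion of the digit sum.
\<close>

lemma card_split_parity:
  fixes P :: "nat \<Rightarrow> bool"
  shows "card {n. n < N \<and> P n} =
    card {n. n < (N + 1) div 2 \<and> P (2 * n)} + card {n. n < N div 2 \<and> P (Suc (2 * n))}"
proof -
  have split: "{n. n < N \<and> P n} =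
      (\<lambda>n. 2 * n) ` {n. n < (N + 1) div 2 \<and> P (2 * n)} \<union>
      (\<lambda>n. Suc (2 * n)) ` {n. n < N div 2 \<and> P (Suc (2 * n))}" (is "?L = ?A \<union> ?B")
  proof (intro equalityI subsetI)
    fix n assume "n \<in> ?L"
    then show "n \<in> ?A \<union> ?B"
      by (cases "even n") (auto elim!: evenE oddE)
  qed auto
  have "?A \<inter> ?B = {}"
    by (auto, presburger)
  then have "card ?L = card ?A + card ?B"
    unfolding split by (intro card_Un_disjoint) auto
  also have "card ?A = card {n. n < (N + 1) div 2 \<and> P (2 * n)}"
    by (rule card_image) (auto simp: inj_on_def)
  also have "card ?B = card {n. n < N div 2 \<and> P (Suc (2 * n))}"
    by (rule card_image) (auto simp: inj_on_def)
  finally show ?thesis .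
qed

lemma half_nat_tendsto:
  "(\<lambda>N. real (N div 2) / real N) \<longlonglongrightarrow> 1 / 2"
  "(\<lambda>N. real ((N + 1) div 2) / real N) \<longlonglongrightarrow> 1 / 2"
proof -
  have inv: "(\<lambda>N. 1 / real N) \<longlonglongrightarrow> 0"
    by (rule lim_1_over_n)
  have lo: "(\<lambda>N. 1 / 2 - 1 / real N) \<longlonglongrightarrow> 1 / 2"
    using tendsto_diff[OF tendsto_const inv, of "1 / 2"] by simp
  have hi: "(\<lambda>N. 1 / 2 + 1 / real N) \<longlonglongrightarrow> 1 / 2"
    using tendsto_add[OF tendsto_const inv, of "1 / 2"] by simp
  have est: "1 / 2 - 1 / real N \<le> real k / real N \<and> real k / real N \<le> 1 / 2 + 1 / real N"
    if "N > 0" "2 * k \<le> N + 1" "N \<le> 2 * k + 1" for N k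
  proof -
    have "real N / 2 - 1 \<le> real k" "real k \<le> real N / 2 + 1"
      using that by linarith+
    then have "(real N / 2 - 1) / real N \<le> real k / real N" "real k / real N \<le> (real N / 2 + 1) / real N"
      by (intro divide_right_mono; simp)+
    then show ?thesis using that(1) by (simp add: diff_divide_distrib add_divide_distrib)
  qed
  show "(\<lambda>N. real (N div 2) / real N) \<longlonglongrightarrow> 1 / 2"
    by (rule tendsto_sandwich[OF _ _ lo hi];
        rule eventually_sequentiallyI[of 1]; use est in force)
  show "(\<lambda>N. real ((N + 1) div 2) / real N) \<longlonglongrightarrow> 1 / 2"
    by (rule tendsto_sandwich[OF _ _ lo hi];
        rule eventually_sequentiallyI[of 1]; use est in force)
qed

lemma has_density_split_parity:
  assumes "has_density (\<lambda>n. P (2 * n)) d" "has_density (\<lambda>n. P (Suc (2 * n))) e"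
  shows "has_density P ((d + e) / 2)"
proof -
  define D E where "D N = real (card {n. n < N \<and> P (2 * n)}) / real N"
    and "E N = real (card {n. n < N \<and> P (Suc (2 * n))}) / real N" for N
  have D: "D \<longlonglongrightarrow> d" and E: "E \<longlonglongrightarrow> e"
    using assms unfolding has_density_def D_def E_def by simp_all
  have top: "filterlim (\<lambda>N::nat. N div 2) at_top at_top"
    "filterlim (\<lambda>N::nat. (N + 1) div 2) at_top at_top"
    unfolding filterlim_at_top eventually_sequentially
    by (intro allI; rule_tac x = "2 * Z" in exI; force)+
  have "(\<lambda>N. D ((N + 1) div 2) * (real ((N + 1) div 2) / real N) + E (N div 2) * (real (N div 2) / real N))
      \<longlonglongrightarrow> d * (1 / 2) + e * (1 / 2)"
    by (intro tendsto_add tendsto_mult half_nat_tendsto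
        filterlim_compose[OF D top(2)] filterlim_compose[OF E top(1)])
  also have "(\<lambda>N. D ((N + 1) div 2) * (real ((N + 1) div 2) / real N) + E (N div 2) * (real (N div 2) / real N))
      = (\<lambda>N. real (card {n. n < N \<and> P n}) / real N)"
  proof
    fix N
    have "real (card {n. n < M \<and> Q n}) / real M * (real M / real N)
        = real (card {n. n < M \<and> Q n}) / real N" for M :: nat and Q
      by (cases "M = 0") auto
    then show "D ((N + 1) div 2) * (real ((N + 1) div 2) / real N) + E (N div 2) * (real (N div 2) / real N)
        = real (card {n. n < N \<and> P n}) / real N"
      unfolding D_def E_def by (subst card_split_parity) (simp add: add_divide_distrib)
  qed
  finally show ?thesis
    unfolding has_density_def by (simp add: add_divide_distrib)
qed

lemma cusick_density_eq:
  assumes "has_density (\<lambda>n. int (bin_digit_sum (n + t)) - int (bin_digit_sum n) \<ge> 0) d"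
  shows "cusick_density t = d"
  using assms unfolding has_density_def cusick_density_def by (intro limI) simp

section \<open>The law of the digit sum increment\<close>

text \<open>
  For \<open>r \<le> 2 ^ l\<close> this is the mean of \<open>f (s ((k + r) mod 2 ^ l) - s k)\<close> over all \<open>k < 2 ^ l\<close>, where \<open>s\<close>
  is the binary digit sum. The recursion reads off the lowest digit of \<open>k\<close>. When \<open>r\<close> is odd, a
  digit 0 of \<open>k\<close> becomes 1 without a carry, and a digit 1 becomes 0 and sends a
  carry to the remaining digits, which then have to absorb \<open>r div 2 + 1\<close>.
\<close>

fun increment_mean :: "nat \<Rightarrow> nat \<Rightarrow> (int \<Rightarrow> real) \<Rightarrow> real" where
  "increment_mean 0 r f = f 0"
| "increment_mean (Suc l) r f =
    (if even r then increment_mean l (r div 2) f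
     else (increment_mean l (r div 2) (\<lambda>x. f (x + 1))
         + increment_mean l (r div 2 + 1) (\<lambda>x. f (x - 1))) / 2)"

text \<open>
  The density of the \<open>n\<close> for which the digit sum rises by at least \<open>x\<close> from \<open>n\<close> to \<open>n + 1\<close>, as
  \<open>has_density_increment_one\<close> shows. Truncation by \<^const>\<open>nat\<close> gives the value 0 for \<open>x \<ge> 2\<close>.
\<close>

definition carry_tail :: "int \<Rightarrow> real" where
  "carry_tail x = 1 - (1 / 2) ^ nat (2 - x)"

lemma increment_mean_even: "increment_mean (Suc l) (2 * q) f = increment_mean l q f"
  by simp

lemma increment_mean_odd:
  "increment_mean (Suc l) (Suc (2 * q)) f =
    (increment_mean l q (\<lambda>x. f (x + 1)) + increment_mean l (Suc q) (\<lambda>x. f (x - 1))) / 2"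
  by simp

declare increment_mean.simps(2) [simp del]

lemma has_density_increment_even:
  assumes "has_density (\<lambda>n. int (bin_digit_sum (n + q)) - int (bin_digit_sum n) \<ge> x) d"
  shows "has_density (\<lambda>n. int (bin_digit_sum (n + 2 * q)) - int (bin_digit_sum n) \<ge> x) d"
proof -
  have e: "bin_digit_sum (2 * n + 2 * q) = bin_digit_sum (n + q)"
    "bin_digit_sum (Suc (2 * n) + 2 * q) = Suc (bin_digit_sum (n + q))" for n
    using bin_digit_sum_double[of "n + q"] bin_digit_sum_Suc_double[of "n + q"] by simp_all
  have "has_density (\<lambda>n. int (bin_digit_sum (n + 2 * q)) - int (bin_digit_sum n) \<ge> x) ((d + d) / 2)"
    by (rule has_density_split_parity; unfold e bin_digit_sum_double bin_digit_sum_Suc_double)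
       (use assms in simp_all)
  then show ?thesis by simp
qed

lemma has_density_increment_odd:
  assumes "has_density (\<lambda>n. int (bin_digit_sum (n + q)) - int (bin_digit_sum n) \<ge> x - 1) d"
    and "has_density (\<lambda>n. int (bin_digit_sum (n + Suc q)) - int (bin_digit_sum n) \<ge> x + 1) e"
  shows "has_density (\<lambda>n. int (bin_digit_sum (n + Suc (2 * q))) - int (bin_digit_sum n) \<ge> x)
           ((d + e) / 2)"
proof (rule has_density_split_parity)
  have e: "2 * n + Suc (2 * q) = Suc (2 * (n + q))" "Suc (2 * n) + Suc (2 * q) = 2 * (n + Suc q)" for n
    by simp_all
  have "(int (bin_digit_sum (2 * n + Suc (2 * q))) - int (bin_digit_sum (2 * n)) \<ge> x) \<longleftrightarrow>
      (int (bin_digit_sum (n + q)) - int (bin_digit_sum n) \<ge> x - 1)" for n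
    unfolding e bin_digit_sum_double bin_digit_sum_Suc_double by auto
  then show "has_density (\<lambda>n. int (bin_digit_sum (2 * n + Suc (2 * q))) - int (bin_digit_sum (2 * n)) \<ge> x) d"
    using assms(1) by presburger
  have "(int (bin_digit_sum (Suc (2 * n) + Suc (2 * q))) - int (bin_digit_sum (Suc (2 * n))) \<ge> x) \<longleftrightarrow>
      (int (bin_digit_sum (n + Suc q)) - int (bin_digit_sum n) \<ge> x + 1)" for n
    unfolding e bin_digit_sum_double bin_digit_sum_Suc_double by auto
  then show "has_density (\<lambda>n. int (bin_digit_sum (Suc (2 * n) + Suc (2 * q)))
      - int (bin_digit_sum (Suc (2 * n))) \<ge> x) e"
    using assms(2) by presburger
qed

lemma bin_digit_sum_Suc_le: "bin_digit_sum (Suc n) \<le> Suc (bin_digit_sum n)"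
proof (induction n rule: less_induct)
  case (less n)
  show ?case
  proof (cases "even n")
    case True
    then show ?thesis
      by (auto elim!: evenE simp: bin_digit_sum_double bin_digit_sum_Suc_double)
  next
    case False
    then obtain m where m: "n = Suc (2 * m)" by (auto elim: oddE)
    have "Suc (Suc (2 * m)) = 2 * Suc m" by simp
    then show ?thesis
      using less[of m] unfolding m by (simp add: bin_digit_sum_double bin_digit_sum_Suc_double
          del: mult_Suc_right)
  qed
qed

text \<open>
  For even \<open>n\<close> the increment is 1. For odd \<open>n\<close> it is 1 less than the increment at
  \<open>n div 2\<close>, so that the tail at \<open>x\<close> is determined by the tail at \<open>x + 1\<close>.
\<close>

lemma has_density_increment_one:
  "has_density (\<lambda>n. int (bin_digit_sum (n + 1)) - int (bin_digit_sum n) \<ge> x) (carry_tail x)"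
proof (induction "nat (2 - x)" arbitrary: x)
  case 0
  have "\<not> int (bin_digit_sum (n + 1)) - int (bin_digit_sum n) \<ge> x" for n
    using bin_digit_sum_Suc_le[of n] 0 by simp
  then show ?case
    using 0 by (simp add: has_density_def carry_tail_def)
next
  case (Suc k)
  have all: "has_density (\<lambda>n. int (bin_digit_sum (n + 0)) - int (bin_digit_sum n) \<ge> x - 1) 1"
    unfolding has_density_def
  proof (rule tendsto_eventually, rule eventually_sequentiallyI[of 1])
    fix N :: nat assume "1 \<le> N"
    moreover have "{n. n < N \<and> int (bin_digit_sum (n + 0)) - int (bin_digit_sum n) \<ge> x - 1} = {..<N}"
      using Suc.hyps(2) by auto
    ultimately show "real (card {n. n < N \<and> int (bin_digit_sum (n + 0)) - int (bin_digit_sum n) \<ge> x - 1}) / real N = 1"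
      by simp
  qed
  have "has_density (\<lambda>n. int (bin_digit_sum (n + Suc 0)) - int (bin_digit_sum n) \<ge> x + 1) (carry_tail (x + 1))"
    using Suc.hyps(1)[of "x + 1"] Suc.hyps(2) by simp
  from has_density_increment_odd[OF all this]
  have "has_density (\<lambda>n. int (bin_digit_sum (n + 1)) - int (bin_digit_sum n) \<ge> x)
      ((1 + carry_tail (x + 1)) / 2)"
    by simp
  moreover have "nat (2 - x) = Suc (nat (2 - (x + 1)))"
    using Suc.hyps(2) by linarith
  then have "(1 + carry_tail (x + 1)) / 2 = carry_tail x"
    by (simp add: carry_tail_def field_simps)
  ultimately show ?case by simp
qed

text \<open>
  The low \<open>l\<close> digits contribute the increment averaged on the right. The remaining part of \<open>n\<close> then
  absorbs 1 or 2, which leads to the same tail because adding 2 acts on \<open>n div 2\<close> as adding 1.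
  This is why \<open>r = 2 ^ l\<close> is covered, a case that the induction needs for the carry.
\<close>

lemma has_density_increment:
  assumes "r \<le> 2 ^ l"
  shows "has_density (\<lambda>n. int (bin_digit_sum (n + (2 ^ l + r))) - int (bin_digit_sum n) \<ge> x)
           (increment_mean l r (\<lambda>y. carry_tail (x - y)))"
  using assms
proof (induction l arbitrary: r x)
  case 0
  then consider "r = 0" | "r = 1" by force
  then show ?case
  proof cases
    case 1
    then show ?thesis using has_density_increment_one[of x] by simp
  next
    case 2
    then show ?thesis
      using has_density_increment_even[OF has_density_increment_one[of x]]
      by (simp add: numeral_2_eq_2)
  qed
next
  case (Suc l)
  show ?case
  proof (cases "even r")
    case True
    then obtain q where q: "r = 2 * q" by (elim evenE)
    have "2 ^ Suc l + r = 2 * (2 ^ l + q)" unfolding q by simp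
    then show ?thesis
      using has_density_increment_even[OF Suc.IH[of q x]] Suc.prems
      unfolding q increment_mean_even by (simp del: distrib_left_numeral)
  next
    case False
    then obtain q where q: "r = Suc (2 * q)" by (auto elim: oddE)
    have le: "q \<le> 2 ^ l" "Suc q \<le> 2 ^ l"
      using Suc.prems unfolding q power_Suc by linarith+
    have e: "2 ^ Suc l + r = Suc (2 * (2 ^ l + q))" unfolding q by simp
    have "has_density (\<lambda>n. int (bin_digit_sum (n + (2 ^ l + q))) - int (bin_digit_sum n) \<ge> x - 1)
        (increment_mean l q (\<lambda>y. carry_tail (x - (y + 1))))"
      using Suc.IH[OF le(1), of "x - 1"] by (simp add: algebra_simps)
    moreover have "has_density (\<lambda>n. int (bin_digit_sum (n + Suc (2 ^ l + q))) - int (bin_digit_sum n) \<ge> x + 1)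
        (increment_mean l (Suc q) (\<lambda>y. carry_tail (x - (y - 1))))"
      using Suc.IH[OF le(2), of "x + 1"] by (simp add: algebra_simps)
    ultimately show ?thesis
      unfolding e unfolding q increment_mean_odd by (rule has_density_increment_odd)
  qed
qed

text \<open>
  The map \<open>k \<mapsto> (k + r) mod 2 ^ l\<close> is inverse to the map with \<open>2 ^ l - r\<close> in place of \<open>r\<close>, and
  interchanging \<open>k\<close> with its image negates the increment. In the recursion this symmetry exchanges
  the two branches of an odd \<open>r\<close>.
\<close>

lemma increment_mean_reflect:
  assumes "r \<le> 2 ^ l"
  shows "increment_mean l (2 ^ l - r) f = increment_mean l r (\<lambda>x. f (- x))"
  using assms
proof (induction l arbitrary: r f)
  case 0
  then show ?case by simp
next
  case (Suc l)
  show ?case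
  proof (cases "even r")
    case True
    then obtain q where q: "r = 2 * q" by (elim evenE)
    have "2 ^ Suc l - r = 2 * (2 ^ l - q)" unfolding q by simp
    then show ?thesis
      using Suc.IH[of q f] Suc.prems unfolding q by (simp add: increment_mean_even del: diff_mult_distrib2)
  next
    case False
    then obtain q where q: "r = Suc (2 * q)" by (auto elim: oddE)
    have le: "q \<le> 2 ^ l" "Suc q \<le> 2 ^ l"
      using Suc.prems unfolding q power_Suc by linarith+
    have e: "2 ^ Suc l - r = Suc (2 * (2 ^ l - Suc q))" and e': "2 ^ l - q = Suc (2 ^ l - Suc q)"
      using le unfolding q by simp_all
    show ?thesis
      unfolding e unfolding q increment_mean_odd unfolding e'[symmetric]
        Suc.IH[OF le(1)] Suc.IH[OF le(2)]
      by (simp add: algebra_simps)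
  qed
qed

lemma increment_mean_add:
  "increment_mean l r (\<lambda>x. f x + g x) = increment_mean l r f + increment_mean l r g"
  by (induction l arbitrary: r f g) (auto simp: increment_mean.simps(2) add_divide_distrib)

lemma increment_mean_scale:
  "increment_mean l r (\<lambda>x. c * f x) = c * increment_mean l r f"
  by (induction l arbitrary: r f) (auto simp: increment_mean.simps(2) field_simps)

lemma increment_mean_const: "increment_mean l r (\<lambda>x. c) = c"
  by (induction l arbitrary: r) (auto simp: increment_mean.simps(2))

lemma increment_mean_mono:
  assumes "\<And>x. f x \<le> g x"
  shows "increment_mean l r f \<le> increment_mean l r g"
  using assms
proof (induction l arbitrary: r f g)
  case (Suc l)
  have "increment_mean l s (\<lambda>x. f (x + c)) \<le> increment_mean l s (\<lambda>x. g (x + c))" for s c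
    by (intro Suc.IH Suc.prems)
  from this[of _ 1] this[of _ "- 1"] Suc.IH[OF Suc.prems] show ?case
    by (auto simp: increment_mean.simps(2) intro!: divide_right_mono add_mono)
qed simp

section \<open>Binomial smoothing\<close>

definition geom :: "int \<Rightarrow> real" where
  "geom x = (1 / 2) ^ nat (\<bar>x\<bar> + 2)"

text \<open>
  The sum of the tails is at least 1 for \<open>\<bar>x\<bar> \<le> 1\<close>; otherwise one of them vanishes and the other
  misses 1 by exactly \<^term>\<open>geom x\<close>.
\<close>

lemma carry_tail_pair_ge: "1 - geom x \<le> carry_tail (- x) + carry_tail x"
proof -
  consider "x \<ge> 2" | "x \<le> -2" | "x = -1" | "x = 0" | "x = 1" by linarith
  then show ?thesis
    by cases (simp_all add: carry_tail_def geom_def nat_add_distrib add.commute eval_nat_numeral)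
qed

lemma geom_sum_le: "(\<Sum>i\<le>n. geom (x + int i)) \<le> 1"
proof -
  \<comment> \<open>\<open>H\<close> is the cumulative sum of \<^const>\<open>geom\<close> over the integers below \<open>x\<close>, with total mass \<open>3 / 4\<close>.\<close>
  define H :: "int \<Rightarrow> real" where "H x = (if x \<le> 0 then (1 / 2) ^ nat (2 - x) else 3 / 4 - (1 / 2) ^ nat (x + 1))"
    for x
  have step: "geom y = H (y + 1) - H y" for y
  proof -
    consider "y \<ge> 1" | "y = 0" | "y \<le> -1" by linarith
    then show ?thesis
    proof cases
      case 1
      then have "nat (2 + y) = Suc (nat (y + 1))" by linarith
      with 1 show ?thesis by (simp add: geom_def H_def add.commute)
    next
      case 2
      then show ?thesis by (simp add: geom_def H_def power2_eq_square)
    next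
      case 3
      then have "nat (2 - y) = Suc (nat (1 - y))" "nat (\<bar>y\<bar> + 2) = nat (2 - y)" by linarith+
      with 3 show ?thesis by (simp add: geom_def H_def)
    qed
  qed
  have "(\<Sum>i\<le>n. geom (x + int i)) = H (x + int n + 1) - H x"
    by (induction n) (simp_all add: step algebra_simps)
  moreover have "H y \<le> 1" "H y \<ge> 0" for y
  proof -
    show "H y \<le> 1" by (auto simp: H_def power_le_one intro: order_trans[of _ "3/4"])
    have "(1 / 2 :: real) ^ nat (y + 1) \<le> (1 / 2) ^ 2" if "y > 0"
      using that by (intro power_decreasing) auto
    then show "H y \<ge> 0" by (auto simp: H_def power2_eq_square)
  qed
  ultimately show ?thesis
    by (smt (verit))
qed

text \<open>
  The mean of \<^const>\<open>geom\<close> at \<open>x\<close> plus the number of heads in \<open>n\<close> tosses of a fair coin.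
\<close>

definition smooth_geom :: "nat \<Rightarrow> int \<Rightarrow> real" where
  "smooth_geom n x = (\<Sum>i\<le>n. real (n choose i) * geom (x + int i)) / 2 ^ n"

lemma smooth_geom_0: "smooth_geom 0 x = geom x"
  by (simp add: smooth_geom_def)

lemma smooth_geom_Suc: "smooth_geom (Suc n) x = (smooth_geom n x + smooth_geom n (x + 1)) / 2"
proof -
  have "(\<Sum>i\<le>Suc n. real (Suc n choose i) * geom (x + int i))
      = geom x + (\<Sum>i\<le>n. real (n choose Suc i) * geom (x + int (Suc i)))
        + (\<Sum>i\<le>n. real (n choose i) * geom (x + int (Suc i)))"
    by (subst sum.atMost_Suc_shift) (simp add: sum.distrib algebra_simps)
  also have "geom x + (\<Sum>i\<le>n. real (n choose Suc i) * geom (x + int (Suc i)))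
      = (\<Sum>i\<le>Suc n. real (n choose i) * geom (x + int i))"
    by (subst sum.atMost_Suc_shift) simp
  also have "\<dots> = (\<Sum>i\<le>n. real (n choose i) * geom (x + int i))" by simp
  finally show ?thesis
    by (simp add: smooth_geom_def field_simps)
qed

lemma smooth_geom_le_one: "smooth_geom n x \<le> 1"
proof (induction n arbitrary: x)
  case 0
  then show ?case by (simp add: smooth_geom_0 geom_def power_le_one)
next
  case (Suc n)
  from Suc[of x] Suc[of "x + 1"] show ?case by (simp add: smooth_geom_Suc)
qed

lemma smooth_geom_antimono:
  assumes "\<And>x. smooth_geom m x \<le> w" "m \<le> n"
  shows "smooth_geom n x \<le> w"
  using assms(2)
proof (induction n arbitrary: x rule: dec_induct)
  case base
  then show ?case by (rule assms(1))
next
  case (step n)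
  from step.IH[of x] step.IH[of "x + 1"] show ?case by (simp add: smooth_geom_Suc)
qed

text \<open>
  The factor \<open>2 * p + 1\<close> is chosen so that the ratio of consecutive left hand sides is
  \<open>(2 * p + 1) * (2 * p + 3) / (2 * p + 2)\<^sup>2\<close>, which is below 1.
\<close>

lemma central_binomial_sq_le:
  "(real ((2 * p) choose p) / 4 ^ p)\<^sup>2 * real (2 * p + 1) \<le> 1"
proof (induction p)
  case 0
  then show ?case by simp
next
  case (Suc p)
  define a where "a = real ((2 * p) choose p) / 4 ^ p"
  have rec: "real ((2 * Suc p) choose Suc p) * (real p + 1)
      = 2 * (2 * real p + 1) * real ((2 * p) choose p)"
  proof -
    have "Suc p * ((2 * Suc p) choose Suc p) = Suc (Suc (2 * p)) * (Suc (2 * p) choose p)"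
      using Suc_times_binomial_eq[of "Suc (2 * p)" p] by (simp add: mult.commute)
    moreover have "Suc p * (Suc (2 * p) choose p) = Suc (2 * p) * ((2 * p) choose p)"
    proof -
      have "Suc (2 * p) choose p = Suc (2 * p) choose Suc p"
        using binomial_symmetric[of p "Suc (2 * p)"] by simp
      then show ?thesis
        using Suc_times_binomial_eq[of "2 * p" p] by (simp add: mult.commute)
    qed
    ultimately have "Suc p * (Suc p * ((2 * Suc p) choose Suc p))
        = Suc p * (2 * (Suc (2 * p) * ((2 * p) choose p)))"
      by (simp add: algebra_simps)
    then have "Suc p * ((2 * Suc p) choose Suc p) = 2 * (Suc (2 * p) * ((2 * p) choose p))"
      by (simp only: mult_cancel1) simp
    then have "real (Suc p * ((2 * Suc p) choose Suc p)) = real (2 * (Suc (2 * p) * ((2 * p) choose p)))"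
      by (rule arg_cong)
    then show ?thesis unfolding of_nat_mult of_nat_Suc by (simp add: algebra_simps)
  qed
  have "real ((2 * Suc p) choose Suc p) / 4 ^ Suc p = a * ((2 * real p + 1) / (2 * real p + 2))"
    using rec unfolding a_def by (simp add: divide_simps) (simp add: algebra_simps)
  then have "(real ((2 * Suc p) choose Suc p) / 4 ^ Suc p)\<^sup>2 * real (2 * Suc p + 1)
      = a\<^sup>2 * real (2 * p + 1) * ((2 * real p + 1) * (2 * real p + 3) / (2 * real p + 2)\<^sup>2)"
    by (simp add: power2_eq_square algebra_simps)
  also have "\<dots> \<le> 1 * 1"
  proof (rule mult_mono)
    show "a\<^sup>2 * real (2 * p + 1) \<le> 1" using Suc unfolding a_def .
    show "(2 * real p + 1) * (2 * real p + 3) / (2 * real p + 2)\<^sup>2 \<le> 1"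
      by (simp add: divide_le_eq power2_eq_square algebra_simps add_pos_nonneg)
  qed simp_all
  finally show ?case by simp
qed

text \<open>
  Since \<^const>\<open>geom\<close> has total mass at most 1, the largest binomial weight bounds its smoothing at
  every point; with an even number of coins this weight is the central one.
\<close>

lemma smooth_geom_small:
  fixes w :: real
  assumes "w > 0"
  shows "\<exists>m. \<forall>x. smooth_geom m x \<le> w"
proof -
  obtain p :: nat where p: "1 / w\<^sup>2 < real p"
    using reals_Archimedean2 by blast
  define a where "a = real ((2 * p) choose p) / 4 ^ p"
  have "1 < w\<^sup>2 * real (2 * p + 1)"
  proof -
    have "1 < w\<^sup>2 * real p" using p assms by (simp add: field_simps)
    also have "\<dots> \<le> w\<^sup>2 * real (2 * p + 1)" by (intro mult_left_mono) auto
    finally show ?thesis .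
  qed
  with central_binomial_sq_le[of p] have "a\<^sup>2 * real (2 * p + 1) < w\<^sup>2 * real (2 * p + 1)"
    unfolding a_def by linarith
  then have "a\<^sup>2 < w\<^sup>2" by (simp add: mult_less_cancel_right)
  then have aw: "a \<le> w" using assms power2_less_imp_less[of a w] by simp
  have "smooth_geom (2 * p) x \<le> w" for x
  proof -
    have "smooth_geom (2 * p) x = (\<Sum>i\<le>2 * p. real ((2 * p) choose i) / 4 ^ p * geom (x + int i))"
      unfolding smooth_geom_def by (simp add: sum_divide_distrib power_mult)
    also have "\<dots> \<le> (\<Sum>i\<le>2 * p. a * geom (x + int i))"
      unfolding a_def
      by (intro sum_mono mult_right_mono divide_right_mono)
         (use binomial_maximum'[of p] in \<open>simp_all add: geom_def\<close>)
    also have "\<dots> = a * (\<Sum>i\<le>2 * p. geom (x + int i))" by (simp add: sum_distrib_left)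
    also have "\<dots> \<le> a * 1"
      by (intro mult_left_mono geom_sum_le) (simp add: a_def)
    finally show ?thesis using aw by simp
  qed
  then show ?thesis by blast
qed

section \<open>Anticoncentration from the blocks of 1s\<close>

text \<open>
  The bound is required for all numbers \<open>n\<close> of coins at once, because each gain is obtained by passing
  from \<open>n\<close> to \<open>n + 1\<close>, which halves the term with \<open>c\<close>. The shift \<open>j\<close> makes the bound stable under the
  translations in the recursion of \<^const>\<open>increment_mean\<close>.
\<close>

definition smooth_mean_bound :: "real \<Rightarrow> nat \<Rightarrow> nat \<Rightarrow> real \<Rightarrow> bool" where
  "smooth_mean_bound w l r c \<longleftrightarrow>
     (\<forall>n j. increment_mean l r (\<lambda>x. smooth_geom n (x + j)) \<le> w + c / 2 ^ n)"

lemma smooth_mean_boundD: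
  "smooth_mean_bound w l r c \<Longrightarrow> increment_mean l r (\<lambda>x. smooth_geom n (x + j)) \<le> w + c / 2 ^ n"
  by (simp add: smooth_mean_bound_def)

lemma smooth_mean_bound_base:
  assumes "\<And>x. smooth_geom m x \<le> w"
  shows "smooth_mean_bound w l r (2 ^ m)"
proof -
  have "0 \<le> smooth_geom m 0"
    by (auto simp: smooth_geom_def geom_def intro!: divide_nonneg_nonneg sum_nonneg)
  then have w: "0 \<le> w" using assms[of 0] by linarith
  have "smooth_geom n x \<le> w + 2 ^ m / 2 ^ n" for n x
  proof (cases "m \<le> n")
    case True
    then show ?thesis
      using smooth_geom_antimono[OF assms True, of x] by (simp add: add_increasing2)
  next
    case False
    then have "(2::real) ^ n \<le> 2 ^ m" by (intro power_increasing) auto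
    then have "1 \<le> (2::real) ^ m / 2 ^ n" by simp
    then show ?thesis using smooth_geom_le_one[of n x] w by linarith
  qed
  then have "increment_mean l r (\<lambda>x. smooth_geom n (x + j)) \<le> increment_mean l r (\<lambda>x. w + 2 ^ m / 2 ^ n)" for n j
    by (intro increment_mean_mono)
  then show ?thesis
    unfolding smooth_mean_bound_def increment_mean_const by blast
qed

lemma smooth_mean_bound_even:
  "smooth_mean_bound w l q c \<Longrightarrow> smooth_mean_bound w (Suc l) (2 * q) c"
  by (simp add: smooth_mean_bound_def increment_mean_even)

lemma smooth_mean_bound_odd:
  assumes "smooth_mean_bound w l q c" "smooth_mean_bound w l (Suc q) d"
  shows "smooth_mean_bound w (Suc l) (Suc (2 * q)) ((c + d) / 2)"
  unfolding smooth_mean_bound_def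
proof (intro allI)
  fix n j
  have "increment_mean (Suc l) (Suc (2 * q)) (\<lambda>x. smooth_geom n (x + j))
    = (increment_mean l q (\<lambda>x. smooth_geom n (x + (1 + j)))
      + increment_mean l (Suc q) (\<lambda>x. smooth_geom n (x + (j - 1)))) / 2"
    unfolding increment_mean_odd by (simp add: algebra_simps)
  also have "\<dots> \<le> ((w + c / 2 ^ n) + (w + d / 2 ^ n)) / 2"
    by (intro divide_right_mono add_mono smooth_mean_boundD assms) simp
  also have "\<dots> = w + (c + d) / 2 / 2 ^ n"
    by (simp add: add_divide_distrib)
  finally show "increment_mean (Suc l) (Suc (2 * q)) (\<lambda>x. smooth_geom n (x + j)) \<le> w + (c + d) / 2 / 2 ^ n" .
qed

text \<open>
  Two means that differ by a unit shift combine into a mean with one more coin.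
\<close>

lemma increment_mean_smooth_geom_Suc:
  "increment_mean l r (\<lambda>x. smooth_geom n (x + j)) + increment_mean l r (\<lambda>x. smooth_geom n (x + (j + 1)))
    = 2 * increment_mean l r (\<lambda>x. smooth_geom (Suc n) (x + j))"
  unfolding increment_mean_add[symmetric] increment_mean_scale[symmetric] smooth_geom_Suc
  by (rule arg_cong[of _ _ "increment_mean l r"]) (simp add: fun_eq_iff add.assoc field_simps)

text \<open>
  Of the four equally weighted terms reached after two digits, two belong to the same remaining summand
  (\<open>q\<close> or \<open>Suc q\<close>) and differ by a unit shift, because two of the four values of the digit
  pair of \<open>k\<close> send the same carry onwards with a different number of carries inside. They merge
  into one more coin, so that \<open>c\<close> becomes \<open>c / 2 + (c / 2) / 2\<close>.
\<close>

lemma smooth_mean_bound_gain: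
  assumes "smooth_mean_bound w l q c" "smooth_mean_bound w l (Suc q) c"
    and p_cases: "p = 2 * q \<or> p = Suc (2 * q)"
  shows "smooth_mean_bound w (Suc (Suc l)) (Suc (2 * p)) (3 / 4 * c)"
  unfolding smooth_mean_bound_def
proof (intro allI)
  fix n j
  let ?M = "\<lambda>r n j. increment_mean l r (\<lambda>x. smooth_geom n (x + j))"
  have B: "?M r n j \<le> w + c / 2 ^ n" if "r = q \<or> r = Suc q" for r n j
    using that assms smooth_mean_boundD by blast
  have half: "?M r n i + ?M r n (i + 1) \<le> 2 * (w + c / 2 ^ Suc n)" if "r = q \<or> r = Suc q" for r i
    unfolding increment_mean_smooth_geom_Suc using B[OF that, of "Suc n" i] by simp
  have "4 * increment_mean (Suc (Suc l)) (Suc (2 * p)) (\<lambda>x. smooth_geom n (x + j))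
      \<le> 2 * (w + c / 2 ^ n) + 2 * (w + c / 2 ^ Suc n)"
    using p_cases
  proof
    assume p: "p = 2 * q"
    have "4 * increment_mean (Suc (Suc l)) (Suc (2 * p)) (\<lambda>x. smooth_geom n (x + j))
      = ?M q n (j + 1) + (?M q n j + ?M q n (j + 1)) + ?M (Suc q) n (j - 2)"
      unfolding p increment_mean_odd increment_mean_even by (simp add: algebra_simps)
    then show ?thesis using half[of q j] B[of q n "j + 1"] B[of "Suc q" n "j - 2"] by simp
  next
    assume p: "p = Suc (2 * q)"
    then have p': "Suc p = 2 * Suc q" by simp
    have "4 * increment_mean (Suc (Suc l)) (Suc (2 * p)) (\<lambda>x. smooth_geom n (x + j))
      = ?M q n (j + 2) + (?M (Suc q) n (j - 1) + ?M (Suc q) n (j - 1 + 1)) + ?M (Suc q) n (j - 1)"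
      unfolding increment_mean_odd p' increment_mean_even unfolding p increment_mean_odd
      by (simp add: algebra_simps)
    then show ?thesis using half[of "Suc q" "j - 1"] B[of q n "j + 2"] B[of "Suc q" n "j - 1"] by simp
  qed
  also have "\<dots> = 4 * (w + 3 / 4 * c / 2 ^ n)"
    by simp
  finally show "increment_mean (Suc (Suc l)) (Suc (2 * p)) (\<lambda>x. smooth_geom n (x + j)) \<le> w + 3 / 4 * c / 2 ^ n"
    by simp
qed

text \<open>
  Counting blocks by their top digits makes the count compatible with removing the lowest digit.
\<close>

definition block_ends :: "nat \<Rightarrow> nat set" where
  "block_ends r = {i. bit r i \<and> \<not> bit r (Suc i)}"

lemma finite_bits: "finite {i. bit (r::nat) i}"
  by (rule finite_subset[of _ "{..<r}"])
     (use not_bit_of_less_power[OF less_exp] linorder_not_le in blast)+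

lemma finite_block_ends: "finite (block_ends r)"
  by (rule finite_subset[OF _ finite_bits[of r]]) (auto simp: block_ends_def)

lemma num_one_blocks_le: "num_one_blocks t \<le> card (block_ends t)"
proof -
  have less: False if "is_one_block t a b" "is_one_block t a' b" "a < a'" for a a' b
    using that unfolding is_one_block_def by force
  have "inj_on snd {(a, b). is_one_block t a b}"
    by (auto simp: inj_on_def) (metis less linorder_neqE_nat)
  moreover have "snd ` {(a, b). is_one_block t a b} \<subseteq> block_ends t"
    by (auto simp: is_one_block_def block_ends_def)
  ultimately show ?thesis
    unfolding num_one_blocks_def by (intro card_inj_on_le[OF _ _ finite_block_ends])
qed

lemma card_block_ends_take_bit:
  assumes t: "t < 2 ^ Suc l" "2 ^ l \<le> t"
  shows "card (block_ends t) \<le> Suc (card (block_ends (take_bit l t)))"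
proof -
  have "t div 2 ^ l = 1"
    using t by (intro div_nat_eqI) auto
  then have "bit t l" by (simp add: bit_iff_odd)
  moreover have "\<not> bit t i" if "l < i" for i
    using not_bit_of_less_power[OF t(1)] that by simp
  ultimately have "block_ends t \<subseteq> insert l (block_ends (take_bit l t))"
    by (auto simp: block_ends_def bit_take_bit_iff) (metis Suc_lessI linorder_neqE_nat)+
  from card_mono[OF _ this] show ?thesis
    by (simp add: finite_block_ends card_insert_if split: if_splits)
qed

lemma card_block_ends_half:
  "card (block_ends r) \<le> card (block_ends (r div 2)) + of_bool (r mod 4 = 1)"
proof -
  have mod4: "r mod 4 = 1" if "bit r 0" "\<not> bit r (Suc 0)"
    using that unfolding bit_Suc bit_0 by presburger
  have "block_ends r \<subseteq> Suc ` block_ends (r div 2) \<union> (if r mod 4 = 1 then {0} else {})"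
  proof
    fix i assume i: "i \<in> block_ends r"
    show "i \<in> Suc ` block_ends (r div 2) \<union> (if r mod 4 = 1 then {0} else {})"
    proof (cases i)
      case 0
      with i mod4 show ?thesis by (auto simp: block_ends_def)
    next
      case (Suc k)
      with i have "k \<in> block_ends (r div 2)" by (simp add: block_ends_def bit_Suc)
      with Suc show ?thesis by blast
    qed
  qed
  then have "card (block_ends r) \<le> card (Suc ` block_ends (r div 2) \<union> (if r mod 4 = 1 then {0} else {}))"
    by (intro card_mono) (auto simp: finite_block_ends)
  also have "\<dots> \<le> card (Suc ` block_ends (r div 2)) + card (if r mod 4 = 1 then {0::nat} else {})"
    by (rule card_Un_le)
  also have "\<dots> = card (block_ends (r div 2)) + of_bool (r mod 4 = 1)"
    by (simp add: card_image)
  finally show ?thesis .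
qed

text \<open>
  The recursion from \<open>r\<close> leads to \<open>r div 2\<close> and its successor, so both are carried along. Whenever \<open>r\<close> ends
  in the digits 10, a group of three digits is consumed: the 0 keeps \<open>r\<close> and half of \<open>Suc r\<close> in the
  situation of \<open>smooth_mean_bound_gain\<close>, and the other half of \<open>Suc r\<close> gains nothing, which gives
  the factor \<open>(3 / 4 + 1) / 2 = 7 / 8\<close>. A group removes at most one block, but it may
  leave an odd number, whose lowest block no longer has a 0 below it and may be lost as well. This
  accounts for two blocks per factor and for the summand for odd \<open>r\<close>.
\<close>

lemma smooth_mean_bound_blocks:
  assumes "\<And>x. smooth_geom m x \<le> w"
    and "r < 2 ^ l" "2 * M + of_bool (odd r) \<le> card (block_ends r)"
  shows "smooth_mean_bound w l r (2 ^ m * (7 / 8) ^ M) \<and> smooth_mean_bound w l (Suc r) (2 ^ m * (7 / 8) ^ M)"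
  using assms(2,3)
proof (induction l arbitrary: r M rule: less_induct)
  case (less l)
  let ?c = "\<lambda>M. 2 ^ m * (7 / 8 :: real) ^ M"
  show ?case
  proof (cases M)
    case 0
    then show ?thesis using smooth_mean_bound_base[OF assms(1)] by simp
  next
    case (Suc M')
    have "r \<noteq> 0"
      using less.prems(2) Suc by (intro notI) (simp add: block_ends_def)
    then obtain l' where l: "l = Suc l'"
      using less.prems(1) by (cases l) auto
    consider q where "r = 2 * q" "even q" | q where "r = Suc (2 * q)" | p where "r = 2 * Suc (2 * p)"
      by (metis oddE evenE Suc_eq_plus1)
    then show ?thesis
    proof cases
      case (1 q)
      then have "q < 2 ^ l'" using less.prems(1) l by simp
      moreover have "2 * M + of_bool (odd q) \<le> card (block_ends q)"
        using card_block_ends_half[of r] less.prems(2) 1 by (auto simp: of_bool_def split: if_splits)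
      ultimately have IH: "smooth_mean_bound w l' q (?c M)" "smooth_mean_bound w l' (Suc q) (?c M)"
        using less.IH[of l' q M] l by auto
      from smooth_mean_bound_even[OF IH(1)] smooth_mean_bound_odd[OF IH] show ?thesis
        unfolding 1(1) l by simp
    next
      case (2 q)
      then have "q < 2 ^ l'" using less.prems(1) l by simp
      moreover have "2 * M + of_bool (odd q) \<le> card (block_ends q)"
      proof -
        have "r mod 4 = 1 \<longleftrightarrow> even q" unfolding 2 by presburger
        then show ?thesis using card_block_ends_half[of r] less.prems(2) 2 by (auto split: if_splits)
      qed
      ultimately have IH: "smooth_mean_bound w l' q (?c M)" "smooth_mean_bound w l' (Suc q) (?c M)"
        using less.IH[of l' q M] l by auto
      from smooth_mean_bound_even[OF IH(2)] smooth_mean_bound_odd[OF IH] show ?thesis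
        unfolding 2 l by simp
    next
      case (3 p)
      define q where "q = p div 2"
      have pq: "p = 2 * q \<or> p = Suc (2 * q)" unfolding q_def by presburger
      have c1: "card (block_ends r) \<le> card (block_ends (Suc (2 * p)))"
      proof -
        have "r mod 4 \<noteq> 1" "r div 2 = Suc (2 * p)" unfolding 3 by presburger+
        then show ?thesis using card_block_ends_half[of r] by simp
      qed
      have c2: "card (block_ends (Suc (2 * p))) \<le> card (block_ends p) + of_bool (even p)"
      proof -
        have "Suc (2 * p) mod 4 = 1 \<longleftrightarrow> even p" by presburger
        then show ?thesis using card_block_ends_half[of "Suc (2 * p)"] by simp
      qed
      have c3: "card (block_ends p) \<le> card (block_ends q) + of_bool (p mod 4 = 1)"
        using card_block_ends_half[of p] unfolding q_def .
      \<comment> \<open>At most one block is lost, as \<open>p\<close> cannot be even and congruent to 1 modulo 4.\<close>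
      have c4: "2 * M' + 1 \<le> card (block_ends q)"
      proof -
        have "of_bool (even p) + of_bool (p mod 4 = 1) \<le> (1 :: nat)"
          by (cases "even p") (auto, presburger)
        then show ?thesis using c1 c2 c3 less.prems(2) Suc by linarith
      qed
      then have "q \<noteq> 0" by (intro notI) (simp add: block_ends_def)
      then have "q \<ge> 1" by simp
      then have "r \<ge> 6" using pq 3 by auto
      have "\<exists>k. l = Suc (Suc (Suc k))"
      proof (rule ccontr)
        assume "\<not> ?thesis"
        then have "l \<le> 2" by presburger
        then have "(2::nat) ^ l \<le> 2 ^ 2" by (intro power_increasing) auto
        with \<open>r \<ge> 6\<close> less.prems(1) show False by simp
      qed
      then obtain k where k: "l = Suc (Suc (Suc k))" by blast
      have "q < 2 ^ k" using less.prems(1) pq 3 k by auto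
      moreover have "2 * M' + of_bool (odd q) \<le> card (block_ends q)"
        using c4 by auto
      ultimately have IH: "smooth_mean_bound w k q (?c M')" "smooth_mean_bound w k (Suc q) (?c M')"
        using less.IH[of k q M'] k by auto
      note gain = smooth_mean_bound_gain[OF IH pq]
      have p1: "smooth_mean_bound w (Suc k) (Suc p) (?c M')"
        using pq
      proof
        assume "p = 2 * q"
        then show ?thesis using smooth_mean_bound_odd[OF IH] by simp
      next
        assume "p = Suc (2 * q)"
        then show ?thesis using smooth_mean_bound_even[OF IH(2)] by simp
      qed
      have p2: "smooth_mean_bound w (Suc (Suc k)) (Suc (Suc (2 * p))) (?c M')"
        using smooth_mean_bound_even[OF p1] by simp
      have weak: "smooth_mean_bound w l r (?c M)" if "smooth_mean_bound w l r (3 / 4 * ?c M')" for l r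
        unfolding smooth_mean_bound_def
      proof (intro allI)
        fix n j
        have "3 / 4 * ?c M' \<le> ?c M" using Suc by simp
        then have "w + 3 / 4 * ?c M' / 2 ^ n \<le> w + ?c M / 2 ^ n"
          by (intro add_left_mono divide_right_mono) auto
        with smooth_mean_boundD[OF that, of n j]
        show "increment_mean l r (\<lambda>x. smooth_geom n (x + j)) \<le> w + ?c M / 2 ^ n" by linarith
      qed
      have "smooth_mean_bound w l r (?c M)"
        using weak[OF smooth_mean_bound_even[OF gain]] unfolding 3 k .
      moreover have "smooth_mean_bound w l (Suc r) (?c M)"
        using smooth_mean_bound_odd[OF gain p2] unfolding 3 k Suc by (simp add: field_simps)
      ultimately show ?thesis ..
    qed
  qed
qed

theorem theorem1p1:
  fixes \<epsilon> :: real
  assumes "\<epsilon> > 0"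
  shows "\<exists>C::nat. \<forall>(t::nat) (l::nat).
           t > 0 \<longrightarrow> num_one_blocks t \<ge> C \<longrightarrow> 2 ^ l \<le> t \<longrightarrow> t < 2 ^ (l + 1) \<longrightarrow>
           cusick_density t + cusick_density (3 * 2 ^ l - t) > 1 - \<epsilon>"
proof -
  obtain m where m: "\<And>x. smooth_geom m x \<le> \<epsilon> / 2"
    using smooth_geom_small[of "\<epsilon> / 2"] assms by auto
  obtain M where M: "(7 / 8 :: real) ^ M < \<epsilon> / 2 / 2 ^ m"
    using real_arch_pow_inv[of "\<epsilon> / 2 / 2 ^ m" "7 / 8"] assms by auto
  show ?thesis
    \<comment> \<open>Of the two extra blocks, one may vanish with the leading digit of \<open>t\<close>, the other accounts for odd \<open>r\<close>.\<close>
  proof (intro exI[of _ "2 * M + 2"] allI impI)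
    fix t l :: nat
    assume blocks: "2 * M + 2 \<le> num_one_blocks t" and t: "2 ^ l \<le> t" "t < 2 ^ (l + 1)"
    define r where "r = t - 2 ^ l"
    have r: "r < 2 ^ l" "r \<le> 2 ^ l" and tr: "t = 2 ^ l + r" and tr': "3 * 2 ^ l - t = 2 ^ l + (2 ^ l - r)"
      using t unfolding r_def by auto
    have "take_bit l t = r"
      unfolding tr by (simp add: take_bit_eq_mod r)
    then have "2 * M + of_bool (odd r) \<le> card (block_ends r)"
      using blocks num_one_blocks_le[of t] card_block_ends_take_bit[of t l] t
      by (auto simp: of_bool_def)
    then have "smooth_mean_bound (\<epsilon> / 2) l r (2 ^ m * (7 / 8) ^ M)"
      using smooth_mean_bound_blocks[OF m r(1)] by blast
    from smooth_mean_boundD[OF this, of 0 0]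
    have "increment_mean l r geom \<le> \<epsilon> / 2 + 2 ^ m * (7 / 8) ^ M"
      by (simp add: smooth_geom_0)
    also have "\<dots> < \<epsilon>"
      using M by (simp add: field_simps)
    finally have small: "increment_mean l r geom < \<epsilon>" .
    have ct: "cusick_density t = increment_mean l r (\<lambda>y. carry_tail (- y))"
      unfolding tr using has_density_increment[OF r(2), of 0] by (intro cusick_density_eq) simp
    have "cusick_density (3 * 2 ^ l - t) = increment_mean l (2 ^ l - r) (\<lambda>y. carry_tail (- y))"
      unfolding tr' using has_density_increment[of "2 ^ l - r" l 0] by (intro cusick_density_eq) simp
    also have "\<dots> = increment_mean l r carry_tail"
      using increment_mean_reflect[OF r(2), of "\<lambda>y. carry_tail (- y)"] by simp
    finally have "cusick_density t + cusick_density (3 * 2 ^ l - t)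
        = increment_mean l r (\<lambda>y. carry_tail (- y) + carry_tail y)"
      unfolding ct increment_mean_add by simp
    also have "\<dots> \<ge> increment_mean l r (\<lambda>y. 1 + (- 1) * geom y)"
      by (intro increment_mean_mono) (use carry_tail_pair_ge in simp)
    also have "increment_mean l r (\<lambda>y. 1 + (- 1) * geom y) = 1 - increment_mean l r geom"
      unfolding increment_mean_add increment_mean_const increment_mean_scale by simp
    finally show "cusick_density t + cusick_density (3 * 2 ^ l - t) > 1 - \<epsilon>"
      using small by linarith
  qed
qed

end
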